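(* Let $R=\bigoplus_{n\geq 0}R_n$ be a graded commutative (i.e. graded and commutative in the ordinary sense) $\mathbf{C}$-algebra with $R_0$ finite dimensional over $\mathbf{C}$ and $R$ finitely generated as an algebra over $R_0$, and let $\kappa\in\mathbf{C}^*$. Then for any $N\geq 0$ the Lie algebra $R^{\kappa}_{\mathrm{Eul},\geq N}$ is finitely generated.
   Context: $R^\kappa_{\mathrm{Eul}}$ denotes the graded Lie algebra with underlying graded vector space $R$ and bracket $[r,s]=\kappa(\deg(r)-\deg(s))\,rs$ for homogeneous $r,s\in R$. $R^{\kappa}_{\mathrm{Eul},\geq N}$ is its Lie subalgebra $\bigoplus_{n\geq N}R_n$. *)

theory Defs
  imports Complex_Main
begin

section \<open>Lie algebras and finite generation\<close>

locale lie_algebra = vector_space scale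
  for scale :: "'k::field \<Rightarrow> 'a::ab_group_add \<Rightarrow> 'a" (infixr \<open>*s\<close> 75) +
  fixes L :: "'a set" and br :: "'a \<Rightarrow> 'a \<Rightarrow> 'a"
  assumes subspace_carrier: "subspace L"
    and br_closed: "x \<in> L \<Longrightarrow> y \<in> L \<Longrightarrow> br x y \<in> L"
    and br_add_left: "x \<in> L \<Longrightarrow> y \<in> L \<Longrightarrow> z \<in> L \<Longrightarrow> br (x + y) z = br x z + br y z"
    and br_add_right: "x \<in> L \<Longrightarrow> y \<in> L \<Longrightarrow> z \<in> L \<Longrightarrow> br x (y + z) = br x y + br x z"
    and br_scale_left: "x \<in> L \<Longrightarrow> y \<in> L \<Longrightarrow> br (c *s x) y = c *s br x y"
    and br_scale_right: "x \<in> L \<Longrightarrow> y \<in> L \<Longrightarrow> br x (c *s y) = c *s br x y"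
    and br_self: "x \<in> L \<Longrightarrow> br x x = 0"
    and jacobi: "x \<in> L \<Longrightarrow> y \<in> L \<Longrightarrow> z \<in> L \<Longrightarrow>
      br x (br y z) + br y (br z x) + br z (br x y) = 0"
begin

definition lie_subalgebra :: "'a set \<Rightarrow> bool" where
  "lie_subalgebra H \<longleftrightarrow> subspace H \<and> H \<subseteq> L \<and> (\<forall>x\<in>H. \<forall>y\<in>H. br x y \<in> H)"

definition lie_finitely_generated :: bool where
  "lie_finitely_generated \<longleftrightarrow> (\<exists>S. finite S \<and> S \<subseteq> L \<and> lie_subalgebra hull S = L)"

end

section \<open>Graded commutative algebras over the complex numbers\<close>

text \<open>The sort below describes commutative rings with unit in which \<open>0 = 1\<close> is not excluded,
  so that the zero algebra is covered; the class \<open>comm_ring_1\<close> would exclude it.\<close>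

locale graded_algebra = vector_space scale
  for scale :: "complex \<Rightarrow> 'a::{comm_ring, comm_monoid_mult} \<Rightarrow> 'a" (infixr \<open>*s\<close> 75) +
  fixes G :: "nat \<Rightarrow> 'a set"
  assumes scale_mult_left: "(c *s x) * y = c *s (x * y)"
    and subspace_G: "subspace (G n)"
    and one_in_G: "1 \<in> G 0"
    and mult_in_G: "x \<in> G m \<Longrightarrow> y \<in> G n \<Longrightarrow> x * y \<in> G (m + n)"
    and direct_sum: "\<exists>!f. (\<forall>n. f n \<in> G n) \<and> finite {n. f n \<noteq> 0} \<and> r = (\<Sum>n | f n \<noteq> 0. f n)"
begin

text \<open>\<open>component r n\<close> is the degree \<open>n\<close> part of \<open>r\<close>.\<close>

definition component :: "'a \<Rightarrow> nat \<Rightarrow> 'a" where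
  "component r = (THE f. (\<forall>n. f n \<in> G n) \<and> finite {n. f n \<noteq> 0} \<and> r = (\<Sum>n | f n \<noteq> 0. f n))"

text \<open>The bilinear extension of \<open>[r, s] = \<kappa> (deg r - deg s) r s\<close> from homogeneous elements;
  see \<open>eul_bracket_homogeneous\<close> below.\<close>

definition eul_bracket :: "complex \<Rightarrow> 'a \<Rightarrow> 'a \<Rightarrow> 'a" where
  "eul_bracket \<kappa> r s =
    (\<Sum>m | component r m \<noteq> 0. \<Sum>n | component s n \<noteq> 0.
      (\<kappa> * (of_nat m - of_nat n)) *s (component r m * component s n))"

definition eul_ge :: "nat \<Rightarrow> 'a set" where
  "eul_ge N = span (\<Union>n\<in>{N..}. G n)"

definition finite_dim_degree_zero :: bool where
  "finite_dim_degree_zero \<longleftrightarrow> (\<exists>B. finite B \<and> span B = G 0)"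

definition unital_subring :: "'a set \<Rightarrow> bool" where
  "unital_subring T \<longleftrightarrow> 1 \<in> T \<and> (\<forall>x\<in>T. \<forall>y\<in>T. x - y \<in> T \<and> x * y \<in> T)"

text \<open>The subalgebra over \<open>G 0\<close> generated by \<open>S\<close> is the smallest unital subring containing
  \<open>G 0 \<union> S\<close>.\<close>

definition finitely_generated_over_degree_zero :: bool where
  "finitely_generated_over_degree_zero \<longleftrightarrow>
    (\<exists>S. finite S \<and> unital_subring hull (G 0 \<union> S) = UNIV)"

lemma component_props:
  shows component_in: "component r n \<in> G n"
    and finite_component: "finite {n. component r n \<noteq> 0}"
    and sum_component: "(\<Sum>n | component r n \<noteq> 0. component r n) = r"
  using theI'[OF direct_sum[of r]] unfolding component_def by auto

lemma component_unique:
  assumes "\<And>n. f n \<in> G n" "finite {n. f n \<noteq> 0}" "r = (\<Sum>n | f n \<noteq> 0. f n)"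
  shows "component r = f"
  unfolding component_def using assms by (intro the1_equality[OF direct_sum]) blast

lemma component_homogeneous:
  assumes "r \<in> G m"
  shows "component r = (\<lambda>n. if n = m then r else 0)"
proof (rule component_unique)
  have *: "{n. (if n = m then r else 0) \<noteq> 0} = (if r = 0 then {} else {m})" by auto
  show "(if n = m then r else 0) \<in> G n" for n
    using assms subspace_0[OF subspace_G] by auto
  show "finite {n. (if n = m then r else 0) \<noteq> 0}" unfolding * by auto
  show "r = (\<Sum>n | (if n = m then r else 0) \<noteq> 0. if n = m then r else 0)" unfolding * by auto
qed

lemma eul_bracket_homogeneous:
  assumes "r \<in> G m" "s \<in> G n"
  shows "eul_bracket \<kappa> r s = (\<kappa> * (of_nat m - of_nat n)) *s (r * s)"
proof -
  have "{k. component r k \<noteq> 0} = (if r = 0 then {} else {m})"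
    "{k. component s k \<noteq> 0} = (if s = 0 then {} else {n})"
    using assms by (auto simp: component_homogeneous split: if_splits)
  then show ?thesis
    using assms by (auto simp: eul_bracket_def component_homogeneous)
qed

lemma scale_mult_right: "x * (c *s y) = c *s (x * y)"
  by (metis mult.commute scale_mult_left)

lemma sum_component_superset:
  assumes "finite A" "{n. component r n \<noteq> 0} \<subseteq> A"
  shows "(\<Sum>n\<in>A. component r n) = r"
proof -
  have "(\<Sum>n\<in>A. component r n) = (\<Sum>n | component r n \<noteq> 0. component r n)"
    using assms by (intro sum.mono_neutral_right) auto
  then show ?thesis by (simp add: sum_component)
qed

lemma component_add: "component (r + s) n = component r n + component s n"
proof -
  let ?f = "\<lambda>n. component r n + component s n"
  let ?A = "{n. component r n \<noteq> 0} \<union> {n. component s n \<noteq> 0}"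
  have fin: "finite ?A" using finite_component by blast
  have sub: "{n. ?f n \<noteq> 0} \<subseteq> ?A" by auto
  have "(\<Sum>n | ?f n \<noteq> 0. ?f n) = (\<Sum>n\<in>?A. ?f n)"
    using fin sub by (intro sum.mono_neutral_left) auto
  also have "\<dots> = r + s"
    using fin by (simp add: sum.distrib sum_component_superset)
  finally have "component (r + s) = ?f"
    using component_in subspace_add[OF subspace_G] finite_subset[OF sub fin]
    by (intro component_unique) auto
  then show ?thesis by simp
qed

lemma component_scale: "component (c *s r) n = c *s component r n"
proof (cases "c = 0")
  case True
  have "component 0 = (\<lambda>_. 0)"
    using component_homogeneous[OF subspace_0[OF subspace_G]] by auto
  with True show ?thesis by simp
next
  case False
  then have "{n. c *s component r n \<noteq> 0} = {n. component r n \<noteq> 0}" by auto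
  then have "component (c *s r) = (\<lambda>n. c *s component r n)"
    using component_in subspace_scale[OF subspace_G] finite_component
    by (intro component_unique) (auto simp: scale_sum_right[symmetric] sum_component)
  then show ?thesis by simp
qed

definition euler :: "'a \<Rightarrow> 'a" where
  "euler r = (\<Sum>n | component r n \<noteq> 0. of_nat n *s component r n)"

lemma euler_superset:
  assumes "finite A" "{n. component r n \<noteq> 0} \<subseteq> A"
  shows "euler r = (\<Sum>n\<in>A. of_nat n *s component r n)"
  unfolding euler_def using assms by (intro sum.mono_neutral_left) auto

lemma euler_add: "euler (r + s) = euler r + euler s"
proof -
  let ?A = "{n. component r n \<noteq> 0} \<union> {n. component s n \<noteq> 0}"
  have "finite ?A" using finite_component by blast
  moreover have "{n. component (r + s) n \<noteq> 0} \<subseteq> ?A" by (auto simp: component_add)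
  ultimately show ?thesis
    by (simp add: euler_superset[where A = ?A] component_add scale_right_distrib sum.distrib)
qed

lemma euler_scale: "euler (c *s r) = c *s euler r"
proof -
  let ?A = "{n. component r n \<noteq> 0}"
  have "finite ?A" by (rule finite_component)
  moreover have "{n. component (c *s r) n \<noteq> 0} \<subseteq> ?A" by (auto simp: component_scale)
  ultimately show ?thesis
    by (simp add: euler_superset[where A = ?A] component_scale scale_sum_right mult.commute)
qed

lemma euler_homogeneous:
  assumes "r \<in> G n" shows "euler r = of_nat n *s r"
proof -
  have "{k. component r k \<noteq> 0} \<subseteq> {n}" using assms by (auto simp: component_homogeneous split: if_splits)
  then show ?thesis using assms by (simp add: euler_superset[where A = "{n}"] component_homogeneous)
qed

lemma euler_zero: "euler 0 = 0"
  using euler_scale[of 0 0] by simp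

lemma homogeneous_induct:
  assumes "\<And>n r. r \<in> G n \<Longrightarrow> P r" "\<And>r s. P r \<Longrightarrow> P s \<Longrightarrow> P (r + s)"
  shows "P r"
proof -
  have "P (\<Sum>n\<in>A. component r n)" if "finite A" for A
    using that
  proof induction
    case empty
    show ?case using assms(1)[OF subspace_0[OF subspace_G]] by simp
  next
    case (insert n A)
    then show ?case using assms(2)[OF assms(1)[OF component_in]] by simp
  qed
  from this[OF finite_component[of r]] show ?thesis by (simp add: sum_component)
qed

lemma euler_mult: "euler (r * s) = euler r * s + r * euler s"
proof (induction r rule: homogeneous_induct)
  case (1 m r)
  show ?case
  proof (induction s rule: homogeneous_induct)
    case (1 n s)
    show ?case
      using euler_homogeneous[OF mult_in_G[OF \<open>r \<in> G m\<close> 1]]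
        euler_homogeneous[OF \<open>r \<in> G m\<close>] euler_homogeneous[OF 1]
      by (simp add: scale_mult_left scale_mult_right scale_left_distrib)
  qed (simp add: algebra_simps euler_add)
qed (simp add: algebra_simps euler_add)

lemma eul_bracket_euler: "eul_bracket \<kappa> r s = \<kappa> *s (euler r * s - r * euler s)"
proof -
  let ?A = "{n. component r n \<noteq> 0}" and ?B = "{n. component s n \<noteq> 0}"
  have "eul_bracket \<kappa> r s = (\<Sum>m\<in>?A. \<Sum>n\<in>?B.
      \<kappa> *s ((of_nat m *s component r m) * component s n - component r m * (of_nat n *s component s n)))"
    unfolding eul_bracket_def
    by (intro sum.cong refl)
      (simp add: scale_mult_left scale_mult_right scale_left_diff_distrib[symmetric])
  also have "\<dots> = \<kappa> *s (euler r * (\<Sum>n\<in>?B. component s n) - (\<Sum>m\<in>?A. component r m) * euler s)"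
    by (simp add: euler_def sum_product sum_subtractf scale_sum_right[symmetric])
  finally show ?thesis by (simp add: sum_component)
qed

lemma eul_ge_0: "eul_ge 0 = UNIV"
proof -
  have "r \<in> eul_ge 0" for r
    by (induction r rule: homogeneous_induct)
      (auto simp: eul_ge_def intro: span_base span_add)
  then show ?thesis by auto
qed

lemma eul_bracket_add_left: "eul_bracket \<kappa> (x + y) z = eul_bracket \<kappa> x z + eul_bracket \<kappa> y z"
  unfolding eul_bracket_euler euler_add scale_right_distrib[symmetric] by (simp add: algebra_simps)

lemma eul_bracket_add_right: "eul_bracket \<kappa> x (y + z) = eul_bracket \<kappa> x y + eul_bracket \<kappa> x z"
  unfolding eul_bracket_euler euler_add scale_right_distrib[symmetric] by (simp add: algebra_simps)

lemma eul_bracket_scale_left: "eul_bracket \<kappa> (c *s x) y = c *s eul_bracket \<kappa> x y"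
  unfolding eul_bracket_euler euler_scale scale_mult_left scale_right_diff_distrib[symmetric]
  by (rule scale_left_commute)

lemma eul_bracket_scale_right: "eul_bracket \<kappa> x (c *s y) = c *s eul_bracket \<kappa> x y"
  unfolding eul_bracket_euler euler_scale scale_mult_right scale_right_diff_distrib[symmetric]
  by (rule scale_left_commute)

lemmas eul_bracket_linear = eul_bracket_add_left eul_bracket_add_right
  eul_bracket_scale_left eul_bracket_scale_right

lemma eul_bracket_in_eul_ge:
  assumes "r \<in> eul_ge N" "s \<in> eul_ge N"
  shows "eul_bracket \<kappa> r s \<in> eul_ge N"
proof -
  let ?V = "\<Union>n\<in>{N..}. G n"
  have 1: "eul_bracket \<kappa> r s \<in> span ?V" if "r \<in> ?V" "s \<in> ?V" for r s
  proof -
    from that obtain m n where mn: "m \<ge> N" "r \<in> G m" "n \<ge> N" "s \<in> G n" by auto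
    then have "r * s \<in> ?V" using mult_in_G[of r m s n] by force
    then show ?thesis using mn by (simp add: eul_bracket_homogeneous span_scale span_base)
  qed
  have 2: "eul_bracket \<kappa> r s \<in> span ?V" if r: "r \<in> ?V" and s: "s \<in> span ?V" for r s
    using s
  proof (induction rule: span_induct_alt)
    case base
    show ?case by (simp add: eul_bracket_euler euler_zero span_zero)
  next
    case (step c x y)
    with 1[OF r] show ?case by (simp add: eul_bracket_linear span_add span_scale)
  qed
  from assms(1) show ?thesis
    unfolding eul_ge_def
  proof (induction rule: span_induct_alt)
    case base
    show ?case by (simp add: eul_bracket_euler euler_zero span_zero)
  next
    case (step c x y)
    with 2[of x s] assms(2) show ?case
      by (simp add: eul_bracket_linear span_add span_scale eul_ge_def)
  qed
qed

lemma eul_bracket_jacobi: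
  "eul_bracket \<kappa> x (eul_bracket \<kappa> y z) + eul_bracket \<kappa> y (eul_bracket \<kappa> z x)
    + eul_bracket \<kappa> z (eul_bracket \<kappa> x y) = 0"
proof -
  have diff: "euler (a - b) = euler a - euler b" for a b
    using euler_add[of "a - b" b] by (simp add: algebra_simps)
  have *: "eul_bracket \<kappa> x (eul_bracket \<kappa> y z) =
     (\<kappa> * \<kappa>) *s (euler x * (euler y * z - y * euler z) - x * euler (euler y * z - y * euler z))"
    for x y z
    by (simp add: eul_bracket_euler[of _ x] eul_bracket_euler[of _ y] euler_scale
        scale_mult_right scale_right_diff_distrib[symmetric])
  show ?thesis
    unfolding * scale_right_distrib[symmetric]
    by (simp add: diff euler_mult algebra_simps)
qed

text \<open>For \<open>N = 0\<close> this says that all of \<open>R\<close> is a Lie algebra, by \<open>eul_ge_0\<close>.\<close>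

lemma lie_algebra_eul_ge: "lie_algebra scale (eul_ge N) (eul_bracket \<kappa>)"
proof unfold_locales
  show "subspace (eul_ge N)" unfolding eul_ge_def by (rule subspace_span)
  show "eul_bracket \<kappa> x x = 0" for x by (simp add: eul_bracket_euler mult.commute)
qed (simp_all add: eul_bracket_in_eul_ge eul_bracket_jacobi eul_bracket_linear)

end

end

theory Submission
  imports Defs
begin

text \<open>
  The idea is that a product \<open>u * v\<close> of homogeneous elements is a multiple of their bracket as soon
  as \<open>deg u \<noteq> deg v\<close>: it is \<open>[u, v]\<close> divided by \<open>\<kappa> (deg u - deg v)\<close>.  So an element of large
  degree lies in a Lie subalgebra \<open>H\<close> if it is a sum of products of two factors of distinct, smaller
  degrees in which \<open>H\<close> is already known to contain everything.

  Such a factorisation exists because \<open>R\<close> is generated over \<open>R\<^sub>0\<close> by homogeneous elements of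
  degrees between \<open>1\<close> and some \<open>D\<close>.  Multiplying the generators in a monomial one at a time raises
  the degree in steps of at most \<open>D\<close>, so for every \<open>K\<close> at most the degree of the monomial, some
  partial product has degree in \<open>[K, K + D]\<close> (lemma \<open>window_factorization\<close>).  For \<open>K = max N 1\<close>
  and total degree above \<open>2 (K + D)\<close>, the complementary factor has degree above \<open>K + D\<close>, hence
  different from that of the partial product.  Therefore \<open>\<Oplus>\<^bsub>n\<ge>N\<^esub> R\<^sub>n\<close> is generated as a Lie
  algebra by its parts of degree at most \<open>2 (K + D)\<close> (lemma \<open>bracket_closed_contains_all_degrees\<close>).
  Each of these finitely many parts is finite dimensional, because splitting off one of the finitely
  many generators bounds the dimension of \<open>R\<^sub>n\<close> in terms of those in smaller degrees, and
  ultimately of that of \<open>R\<^sub>0\<close> (lemma \<open>finite_dim_homogeneous_part\<close>).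

  Monomials are never written down.  All that is used about them is that every element of positive
  degree is a sum of products with a homogeneous generator as first factor
  (lemma \<open>homogeneous_eq_split_part\<close>).
\<close>

context graded_algebra
begin

section \<open>Splitting off a generator\<close>

text \<open>The generators split off are the homogeneous components of positive degree of elements of
  \<open>S\<close>; in degree \<open>0\<close> there is nothing to split off, and all of \<open>G 0\<close> is taken, so that the
  \<open>split_part S n\<close> together form a graded subring.\<close>

definition split_part :: "'a set \<Rightarrow> nat \<Rightarrow> 'a set" where
  "split_part S n = (if n = 0 then G 0
     else span {component s d * v | s d v m. s \<in> S \<and> 0 < d \<and> d + m = n \<and> v \<in> G m})"

lemma split_partI:
  assumes "s \<in> S" "0 < d" "v \<in> G m"
  shows "component s d * v \<in> split_part S (d + m)"
proof -
  have "component s d * v \<in> span {component s e * v | s e v k. s \<in> S \<and> 0 < e \<and> e + k = d + m \<and> v \<in> G k}"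
    using assms by (intro span_base CollectI exI[of _ s] exI[of _ d] exI[of _ v] exI[of _ m] conjI refl)
  then show ?thesis using assms by (simp add: split_part_def)
qed

lemma subspace_split_part: "subspace (split_part S n)"
  by (simp add: split_part_def subspace_G)

lemma split_part_subset: "split_part S n \<subseteq> G n"
proof (cases "n = 0")
  case False
  have "span {component s d * v | s d v m. s \<in> S \<and> 0 < d \<and> d + m = n \<and> v \<in> G m} \<subseteq> G n"
    by (rule span_minimal[OF _ subspace_G]) (auto intro: mult_in_G component_in)
  then show ?thesis using False by (simp add: split_part_def)
qed (simp add: split_part_def)

lemma split_part_mult_right:
  assumes "0 < m" "x \<in> split_part S m" "y \<in> G n"
  shows "x * y \<in> split_part S (m + n)"
proof -
  have "x \<in> span {component s d * v | s d v k. s \<in> S \<and> 0 < d \<and> d + k = m \<and> v \<in> G k}"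
    using assms by (simp add: split_part_def)
  then show ?thesis
  proof (induction rule: span_induct_alt)
    case base
    show ?case by (simp add: subspace_0[OF subspace_split_part])
  next
    case (step c x x')
    then obtain s d v k where sdvk: "x = component s d * v" "s \<in> S" "0 < d" "d + k = m" "v \<in> G k"
      by blast
    have "component s d * (v * y) \<in> split_part S (m + n)"
      using split_partI[OF sdvk(2,3) mult_in_G[OF sdvk(5) assms(3)]]
      by (simp add: sdvk(4)[symmetric] add.assoc)
    with step.IH show ?case
      by (simp add: sdvk(1) distrib_right scale_mult_left mult.assoc
          subspace_add[OF subspace_split_part] subspace_scale[OF subspace_split_part])
  qed
qed

lemma split_part_mult:
  assumes "x \<in> split_part S m" "y \<in> split_part S n"
  shows "x * y \<in> split_part S (m + n)"
proof (cases "m = 0")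
  case False
  then show ?thesis using split_part_mult_right assms split_part_subset by blast
next
  case m: True
  show ?thesis
  proof (cases "n = 0")
    case True
    then show ?thesis using m assms mult_in_G[of x 0 y 0] by (simp add: split_part_def)
  next
    case False
    have "y * x \<in> split_part S (n + m)"
      using False split_part_mult_right assms split_part_subset by blast
    then show ?thesis by (simp add: mult.commute add.commute)
  qed
qed

text \<open>The elements whose components all lie in the corresponding \<open>split_part\<close> form a subring that
  contains \<open>G 0\<close> and \<open>S\<close>; hence, if these generate, that subring is everything.\<close>

lemma homogeneous_eq_split_part:
  assumes gen: "unital_subring hull (G 0 \<union> S) = UNIV"
  shows "G n = split_part S n"
proof
  define T where "T = {r. \<forall>n. component r n \<in> split_part S n}"
  have "component 0 = (\<lambda>n. 0)"
    using component_homogeneous[OF subspace_0[OF subspace_G]] by auto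
  then have zero: "component 0 n = 0" for n by simp
  have subspace_T: "subspace T"
    unfolding T_def
    by (rule subspaceI)
      (auto simp: component_add component_scale zero
        subspace_0[OF subspace_split_part] subspace_add[OF subspace_split_part]
        subspace_scale[OF subspace_split_part])
  have homogeneous_T: "r \<in> T" if "r \<in> split_part S m" for r m
    using that split_part_subset[of S m]
    by (auto simp: T_def component_homogeneous subspace_0[OF subspace_split_part])
  have mult_T: "x * y \<in> T" if "x \<in> T" "y \<in> T" for x y
  proof -
    have "x * y = (\<Sum>m | component x m \<noteq> 0. \<Sum>n | component y n \<noteq> 0.
        component x m * component y n)"
      by (simp only: sum_product[symmetric] sum_component)
    also have "\<dots> \<in> T"
    proof (intro subspace_sum[OF subspace_T])
      fix m n
      show "component x m * component y n \<in> T"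
        using that by (intro homogeneous_T[of _ "m + n"] split_part_mult) (simp_all add: T_def)
    qed
    finally show ?thesis .
  qed
  have "G 0 \<subseteq> T" using homogeneous_T[of _ 0] by (auto simp: split_part_def)
  moreover have "S \<subseteq> T"
  proof
    fix s assume "s \<in> S"
    have "component s n \<in> split_part S n" for n
    proof (cases "n = 0")
      case False
      \<comment> \<open>a component of a generator splits as itself times \<open>1\<close>\<close>
      have "component s n * 1 \<in> split_part S n"
        using split_partI[OF \<open>s \<in> S\<close> _ one_in_G, of n] False by simp
      then show ?thesis by simp
    qed (simp add: split_part_def component_in)
    then show "s \<in> T" by (simp add: T_def)
  qed
  moreover have "unital_subring T"
    unfolding unital_subring_def
    using \<open>G 0 \<subseteq> T\<close> one_in_G mult_T subspace_diff[OF subspace_T] by blast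
  ultimately have "unital_subring hull (G 0 \<union> S) \<subseteq> T" by (intro hull_minimal) auto
  then have "T = UNIV" using gen by auto
  then have "component r n \<in> split_part S n" for r by (auto simp: T_def)
  then show "G n \<subseteq> split_part S n" by (metis component_homogeneous subsetI)
qed (rule split_part_subset)

section \<open>Finite dimensionality of the homogeneous parts\<close>

text \<open>A spanning set in degree \<open>n\<close> consists of the products of generators of degree \<open>d > 0\<close> with
  a finite spanning set in degree \<open>n - d\<close>.\<close>

lemma finite_dim_homogeneous_part:
  assumes gen: "unital_subring hull (G 0 \<union> S) = UNIV" and "finite S"
    and "finite_dim_degree_zero"
  shows "\<exists>B. finite B \<and> span B = G n"
proof (induction n rule: less_induct)
  case (less n)
  show ?case
  proof (cases "n = 0")
    case True
    then show ?thesis using assms(3) by (simp add: finite_dim_degree_zero_def)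
  next
    case False
    obtain B where B: "\<And>m. m < n \<Longrightarrow> finite (B m) \<and> span (B m) = G m"
      using less by metis
    define C where "C = (\<Union>s\<in>S. \<Union>d\<in>{1..n}. (\<lambda>b. component s d * b) ` B (n - d))"
    have "finite C" using B \<open>finite S\<close> False by (auto simp: C_def)
    have "C \<subseteq> G n"
    proof
      fix x assume "x \<in> C"
      then obtain s d b where sdb: "x = component s d * b" "1 \<le> d" "d \<le> n" "b \<in> B (n - d)"
        by (auto simp: C_def)
      then have "b \<in> G (n - d)" using B[of "n - d"] span_base[of b "B (n - d)"] by auto
      then show "x \<in> G n" using mult_in_G[OF component_in, of b "n - d" s d] sdb by simp
    qed
    then have 1: "span C \<subseteq> G n" by (rule span_minimal[OF _ subspace_G])
    have "component s d * v \<in> span C" if "s \<in> S" "0 < d" "d + m = n" "v \<in> G m" for s d v m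
    proof -
      have m: "m = n - d" "m < n" using that by auto
      then have "v \<in> span (B m)" using that B by simp
      then show ?thesis
      proof (induction rule: span_induct_alt)
        case base
        show ?case by (simp add: span_zero)
      next
        case (step c b w)
        have "component s d * b \<in> C"
          unfolding C_def using step(1) that m by (intro UN_I[of s] UN_I[of d] imageI) auto
        with step.IH show ?case
          by (simp add: distrib_left scale_mult_right span_add span_scale span_base)
      qed
    qed
    then have "split_part S n \<subseteq> span C"
      using False by (simp add: split_part_def) (rule span_minimal[OF _ subspace_span], blast)
    with 1 \<open>finite C\<close> show ?thesis using homogeneous_eq_split_part[OF gen] by blast
  qed
qed

section \<open>Factorisations with a prescribed range of degrees\<close>

text \<open>Induction on \<open>K\<close> moves the window up by one: first factors of degree exactly \<open>K\<close> are no longer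
  admitted for \<open>K + 1\<close>, so a generator is split off from the second factor and moved to the first
  one, which raises the degree of the latter by at least \<open>1\<close> and at most \<open>D\<close>.\<close>

lemma window_factorization:
  assumes gen: "unital_subring hull (G 0 \<union> S) = UNIV"
    and D: "\<And>s d. s \<in> S \<Longrightarrow> D < d \<Longrightarrow> component s d = 0"
    and "K \<le> n"
  shows "G n \<subseteq> span {u * v | u v a b. u \<in> G a \<and> v \<in> G b \<and> a + b = n \<and> K \<le> a \<and> a \<le> K + D}"
  using \<open>K \<le> n\<close>
proof (induction K)
  case 0
  show ?case
  proof
    fix r assume "r \<in> G n"
    then have "1 * r \<in> {u * v | u v a b. u \<in> G a \<and> v \<in> G b \<and> a + b = n \<and> 0 \<le> a \<and> a \<le> 0 + D}"
      using one_in_G by (intro CollectI exI[of _ 1] exI[of _ r] exI[of _ 0] exI[of _ n]) simp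
    then show "r \<in> span {u * v | u v a b. u \<in> G a \<and> v \<in> G b \<and> a + b = n \<and> 0 \<le> a \<and> a \<le> 0 + D}"
      by (simp add: span_base)
  qed
next
  case (Suc K)
  let ?P = "{u * v | u v a b. u \<in> G a \<and> v \<in> G b \<and> a + b = n \<and> Suc K \<le> a \<and> a \<le> Suc K + D}"
  have *: "u * v \<in> span ?P"
    if "u \<in> G a" "v \<in> G b" "a + b = n" "Suc K \<le> a" "a \<le> Suc K + D" for u v a b
    using that by (intro span_base) blast
  have "u * v \<in> span ?P"
    if uv: "u \<in> G a" "v \<in> G b" "a + b = n" "K \<le> a" "a \<le> K + D" for u v a b
  proof (cases "a = K")
    case False
    then show ?thesis using uv by (intro *) auto
  next
    case True
    then have "b \<noteq> 0" using uv Suc.prems by auto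
    then have "v \<in> span {component s d * w | s d w m. s \<in> S \<and> 0 < d \<and> d + m = b \<and> w \<in> G m}"
      using uv(2) homogeneous_eq_split_part[OF gen, of b] by (simp add: split_part_def)
    then show ?thesis
    proof (induction rule: span_induct_alt)
      case base
      show ?case by (simp add: span_zero)
    next
      case (step c x y)
      then obtain s d w m where
        sdwm: "x = component s d * w" "s \<in> S" "0 < d" "d + m = b" "w \<in> G m"
        by blast
      have "u * component s d * w \<in> span ?P"
      proof (cases "d \<le> D")
        case True
        then show ?thesis
          using \<open>a = K\<close> uv sdwm mult_in_G[OF uv(1) component_in]
          by (intro *[of _ "a + d" _ m]) auto
      next
        case False
        then show ?thesis using D sdwm by (simp add: span_zero)
      qed
      with step.IH show ?case
        by (simp add: sdwm(1) distrib_left scale_mult_right mult.assoc span_add span_scale)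
    qed
  qed
  then have "span {u * v | u v a b. u \<in> G a \<and> v \<in> G b \<and> a + b = n \<and> K \<le> a \<and> a \<le> K + D}
      \<subseteq> span ?P"
    by (intro span_minimal[OF _ subspace_span]) auto
  with Suc show ?case by auto
qed

section \<open>Generation by low degrees\<close>

lemma mult_in_bracket_closed:
  assumes "subspace H" and closed: "\<And>x y. x \<in> H \<Longrightarrow> y \<in> H \<Longrightarrow> eul_bracket \<kappa> x y \<in> H"
    and "\<kappa> \<noteq> 0" and "u \<in> G a" "u \<in> H" "v \<in> G b" "v \<in> H" "a \<noteq> b"
  shows "u * v \<in> H"
proof -
  let ?c = "\<kappa> * (of_nat a - of_nat b)"
  have "?c \<noteq> 0" using assms by simp
  have "(inverse ?c) *s eul_bracket \<kappa> u v \<in> H"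
    using assms by (intro subspace_scale[OF \<open>subspace H\<close>] closed)
  also have "(inverse ?c) *s eul_bracket \<kappa> u v = u * v"
    unfolding eul_bracket_homogeneous[OF \<open>u \<in> G a\<close> \<open>v \<in> G b\<close>] scale_scale
    by (simp only: left_inverse[OF \<open>?c \<noteq> 0\<close>] scale_one)
  finally show ?thesis .
qed

text \<open>The maximum with \<open>1\<close> matters when \<open>N = 0\<close>: it makes both factors have degree smaller than their
  product, so that the induction on the degree applies to them.\<close>

lemma bracket_closed_contains_all_degrees:
  assumes gen: "unital_subring hull (G 0 \<union> S) = UNIV"
    and D: "\<And>s d. s \<in> S \<Longrightarrow> D < d \<Longrightarrow> component s d = 0"
    and H: "subspace H" "\<And>x y. x \<in> H \<Longrightarrow> y \<in> H \<Longrightarrow> eul_bracket \<kappa> x y \<in> H"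
    and "\<kappa> \<noteq> 0"
    and low: "\<And>n. N \<le> n \<Longrightarrow> n \<le> 2 * (max N 1 + D) \<Longrightarrow> G n \<subseteq> H"
    and "N \<le> n"
  shows "G n \<subseteq> H"
  using \<open>N \<le> n\<close>
proof (induction n rule: less_induct)
  case (less n)
  define K where "K = max N 1"
  show ?case
  proof (cases "n \<le> 2 * (K + D)")
    case True
    then show ?thesis using low less.prems by (simp add: K_def)
  next
    case False
    have "u * v \<in> H"
      if uv: "u \<in> G a" "v \<in> G b" "a + b = n" "K \<le> a" "a \<le> K + D" for u v a b
    proof -
      have "a < b" "N \<le> a" "N \<le> b" "a < n" "b < n" using uv False by (auto simp: K_def)
      then show ?thesis
        using uv less.IH[of a] less.IH[of b]
        by (intro mult_in_bracket_closed[OF H \<open>\<kappa> \<noteq> 0\<close>, of u a v b]) auto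
    qed
    then have "span {u * v | u v a b. u \<in> G a \<and> v \<in> G b \<and> a + b = n \<and> K \<le> a \<and> a \<le> K + D} \<subseteq> H"
      by (intro span_minimal[OF _ H(1)]) auto
    moreover have "K \<le> n" using False by simp
    ultimately show ?thesis using window_factorization[OF gen D] by blast
  qed
qed

lemma components_bounded_degree:
  assumes "finite S"
  obtains D where "\<And>s d. s \<in> S \<Longrightarrow> D < d \<Longrightarrow> component s d = 0"
proof -
  have "finite (\<Union>s\<in>S. {d. component s d \<noteq> 0})" using assms finite_component by blast
  then obtain D where "\<forall>d\<in>(\<Union>s\<in>S. {d. component s d \<noteq> 0}). d \<le> D"
    using finite_nat_set_iff_bounded_le by auto
  then have "component s d = 0" if "s \<in> S" "D < d" for s d using that by force
  then show thesis by (rule that)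
qed

lemma eul_ge_lie_finitely_generated:
  assumes "finite_dim_degree_zero" "finitely_generated_over_degree_zero" "\<kappa> \<noteq> 0"
  shows "lie_algebra.lie_finitely_generated scale (eul_ge N) (eul_bracket \<kappa>)"
proof -
  interpret L: lie_algebra scale "eul_ge N" "eul_bracket \<kappa>" by (rule lie_algebra_eul_ge)
  obtain S where "finite S" and gen: "unital_subring hull (G 0 \<union> S) = UNIV"
    using assms(2) by (auto simp: finitely_generated_over_degree_zero_def)
  obtain D where D: "\<And>s d. s \<in> S \<Longrightarrow> D < d \<Longrightarrow> component s d = 0"
    using components_bounded_degree[OF \<open>finite S\<close>] by blast
  obtain B where B: "\<And>n. finite (B n)" "\<And>n. span (B n) = G n"
    using finite_dim_homogeneous_part[OF gen \<open>finite S\<close> assms(1)] by metis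
  define X where "X = (\<Union>n\<in>{N..2 * (max N 1 + D)}. B n)"
  have "finite X" using B by (simp add: X_def)
  have "X \<subseteq> (\<Union>n\<in>{N..}. G n)" using B span_superset by (fastforce simp: X_def)
  then have "X \<subseteq> eul_ge N" unfolding eul_ge_def using span_superset by blast
  have "eul_ge N \<subseteq> H" if "L.lie_subalgebra H" "X \<subseteq> H" for H
  proof -
    have H: "subspace H" "\<And>x y. x \<in> H \<Longrightarrow> y \<in> H \<Longrightarrow> eul_bracket \<kappa> x y \<in> H"
      using that by (auto simp: L.lie_subalgebra_def)
    have "G n \<subseteq> H" if "N \<le> n" "n \<le> 2 * (max N 1 + D)" for n
    proof -
      have "B n \<subseteq> H" using that \<open>X \<subseteq> H\<close> unfolding X_def UN_subset_iff by simp
      then show ?thesis using span_minimal[OF _ H(1)] B by blast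
    qed
    then have "G n \<subseteq> H" if "N \<le> n" for n
      using bracket_closed_contains_all_degrees[OF gen D H \<open>\<kappa> \<noteq> 0\<close> _ that] by blast
    then show ?thesis unfolding eul_ge_def by (intro span_minimal[OF _ H(1)]) auto
  qed
  then have "eul_ge N \<subseteq> L.lie_subalgebra hull X" by (auto simp: hull_def)
  moreover have "L.lie_subalgebra (eul_ge N)"
    by (simp add: L.lie_subalgebra_def L.subspace_carrier L.br_closed)
  then have "L.lie_subalgebra hull X \<subseteq> eul_ge N" using \<open>X \<subseteq> eul_ge N\<close> by (intro hull_minimal)
  ultimately show ?thesis
    unfolding L.lie_finitely_generated_def using \<open>finite X\<close> \<open>X \<subseteq> eul_ge N\<close> by blast
qed

end

theorem lemma1p5:
  fixes scale :: "complex \<Rightarrow> 'a::{comm_ring, comm_monoid_mult} \<Rightarrow> 'a"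
    and G :: "nat \<Rightarrow> 'a set" and \<kappa> :: complex and N :: nat
  assumes "graded_algebra scale G"
    and "graded_algebra.finite_dim_degree_zero scale G"
    and "graded_algebra.finitely_generated_over_degree_zero G"
    and "\<kappa> \<noteq> 0"
  shows "lie_algebra.lie_finitely_generated scale
           (graded_algebra.eul_ge scale G N) (graded_algebra.eul_bracket scale G \<kappa>)"
  using assms by (rule graded_algebra.eul_ge_lie_finitely_generated)

end
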